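(* Let $f_n(s)$ ($n\geqslant 1$) and $h$ be as below. Then for every $n\geqslant 1$, if $n$ is odd and $s\geqslant 1$, or if $n$ is even and $s\geqslant 2$, $$f_n(s)\leqslant 2e^2 (0.9214)^{n-1} h(s).$$
   Context: The functions $f_n$ are defined by: $f_n(s)=0$ for $s\geqslant n+2$; $sf_1(s)=3-s$ for $1\leqslant s\leqslant 3$; $(sf_n(s))'=-f_{n-1}(s-1)$ for $n\geqslant 2$ even and $s\geqslant 2$; $(sf_n(s))'=-f_{n-1}(s-1)$ for $n\geqslant 2$ odd and $s\geqslant 3$; $(sf_n(s))'=0$ for $n\geqslant 2$ odd and $1\leqslant s\leqslant 3$. The function $h$ is $h(s)=e^{-2}$ for $1\leqslant s\leqslant 2$, $h(s)=e^{-s}$ for $2\leqslant s\leqslant 3$, and $h(s)=3s^{-1}e^{-s}$ for $s\geqslant 3$. *)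

theory Defs
  imports Complex_Main
begin

text \<open>
  The functions \<open>f\<^sub>n\<close> (\<open>n \<ge> 1\<close>) live on \<open>[1, \<infinity>)\<close> for odd \<open>n\<close> and on \<open>[2, \<infinity>)\<close> for even \<open>n\<close>; the
  values outside these domains, and \<open>f 0\<close>, are left unconstrained. Derivatives at the end points of
  the closed intervals are one-sided. This matters at \<open>s = 3\<close> for odd \<open>n \<ge> 3\<close>, where the left
  and right derivatives of \<open>s f\<^sub>n(s)\<close> are \<open>0\<close> and \<open>- f\<^sub>n\<^sub>-\<^sub>1(2)\<close> and need not agree. One-sided
  differentiability makes each \<open>f\<^sub>n\<close> continuous on its domain, so the conditions determine \<open>f\<^sub>n\<close> there
  by integrating down from \<open>s = n + 2\<close>.
\<close>

definition sieve_functions :: "(nat \<Rightarrow> real \<Rightarrow> real) \<Rightarrow> bool" where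
  "sieve_functions f \<longleftrightarrow>
     (\<forall>n\<ge>1. \<forall>s. s \<ge> real n + 2 \<longrightarrow> f n s = 0) \<and>
     (\<forall>s. 1 \<le> s \<and> s \<le> 3 \<longrightarrow> s * f 1 s = 3 - s) \<and>
     (\<forall>n\<ge>2. even n \<longrightarrow> (\<forall>s\<ge>2.
        ((\<lambda>t. t * f n t) has_real_derivative - f (n - 1) (s - 1)) (at s within {2..}))) \<and>
     (\<forall>n\<ge>2. odd n \<longrightarrow> (\<forall>s\<ge>3.
        ((\<lambda>t. t * f n t) has_real_derivative - f (n - 1) (s - 1)) (at s within {3..}))) \<and>
     (\<forall>n\<ge>2. odd n \<longrightarrow> (\<forall>s. 1 \<le> s \<and> s \<le> 3 \<longrightarrow>
        ((\<lambda>t. t * f n t) has_real_derivative 0) (at s within {1..3})))"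

text \<open>Only the values for \<open>s \<ge> 1\<close> are meaningful.\<close>

definition h :: "real \<Rightarrow> real" where
  "h s = (if s \<le> 2 then exp (- 2) else if s \<le> 3 then exp (- s) else 3 * inverse s * exp (- s))"

end

theory Submission
  imports Defs
begin

text \<open>
  Integrating \<open>(s f\<^sub>n(s))' = - f\<^sub>n\<^sub>-\<^sub>1(s - 1)\<close> down from infinity, a bound \<open>f\<^sub>n\<^sub>-\<^sub>1 \<le> K h\<close> gives
  \<open>s f\<^sub>n(s) \<le> K H(s)\<close> with \<open>H(s) = \<integral> h(t - 1) dt\<close> over \<open>[s, \<infinity>)\<close>. For \<open>s \<ge> 3\<close> one has
  \<open>H(s) \<le> 0.9214 s h(s)\<close>, and moreover \<open>H(3) \<le> 0.9214 e\<^sup>-\<^sup>2\<close>; the last inequality is sharp up to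
  \<open>4 \<cdot> 10\<^sup>-\<^sup>5\<close> and settles odd \<open>n\<close> on \<open>[1, 3]\<close>, where \<open>s f\<^sub>n(s)\<close> is constant. For even \<open>n\<close> and
  \<open>s\<close> in \<open>[2, 3]\<close> the bound \<open>f\<^sub>n\<^sub>-\<^sub>1 \<le> K h\<close> is too weak, so the induction also carries the sharper
  \<open>s f\<^sub>n(s) \<le> K e\<^sup>-\<^sup>2\<close> on \<open>[1, 3]\<close> for odd \<open>n\<close>. All integrals are replaced by explicit functions
  with a sufficiently negative derivative.
\<close>

section \<open>Comparison through derivatives\<close>

text \<open>\<open>F - G\<close> has derivative \<open>d - g\<close>, which is nonnegative inside
  the interval, so it increases up to \<open>b\<close>. Working within \<open>{a..}\<close> fits the
  one-sided derivatives at 2 and 3.\<close>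

lemma le_of_deriv_le:
  fixes F G g d :: "real \<Rightarrow> real"
  assumes "a \<le> b"
    and F: "\<And>t. a \<le> t \<Longrightarrow> (F has_real_derivative - g t) (at t within {a..})"
    and G: "\<And>t. a \<le> t \<Longrightarrow> t \<le> b \<Longrightarrow> (G has_real_derivative - d t) (at t)"
    and le: "\<And>t. a < t \<Longrightarrow> t < b \<Longrightarrow> g t \<le> d t"
    and end_le: "F b \<le> G b"
  shows "F a \<le> G a"
proof -
  have "F a - G a \<le> F b - G b"
  proof (rule DERIV_nonneg_imp_increasing_open[OF \<open>a \<le> b\<close>])
    fix x assume x: "a < x" "x < b"
    then have "at x within {a..} = at x"
      by (intro at_within_open_subset[of _ "{a<..}"]) auto
    with F[of x] G[of x] x have "((\<lambda>x. F x - G x) has_real_derivative - g x - - d x) (at x)"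
      by (intro DERIV_diff) auto
    then show "\<exists>y. ((\<lambda>x. F x - G x) has_real_derivative y) (at x) \<and> 0 \<le> y"
      using le[OF x] by (intro exI[of _ "- g x - - d x"]) simp
  next
    have "continuous_on {a..b} F"
      using DERIV_subset[OF F, of _ "{a..b}"]
      by (intro DERIV_continuous_on[of _ _ "\<lambda>t. - g t"]) auto
    moreover have "continuous_on {a..b} G"
      using G by (intro DERIV_continuous_on[of _ _ "\<lambda>t. - d t"])
        (auto intro: has_field_derivative_at_within)
    ultimately show "continuous_on {a..b} (\<lambda>x. F x - G x)"
      by (intro continuous_intros)
  qed
  with end_le show ?thesis by simp
qed

section \<open>Numerical bounds for \<open>exp (- 1)\<close> and the exponential integral\<close>

text \<open>The remainder of even order 8 is positive. Stopping at order 6 would only give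
  0.36666..., while \<open>tail_at_3_le\<close> needs about 0.36781.\<close>

lemma exp_minus_one_ge: "(0.36785::real) \<le> exp (- 1)"
proof -
  obtain t :: real where
    "exp (- 1) = (\<Sum>m<8. (- 1) ^ m / fact m) + (exp t / fact 8) * (- 1) ^ 8"
    using Maclaurin_exp_le[of "- 1 :: real" 8] by auto
  then have "(\<Sum>m<8. (- 1) ^ m / fact m) \<le> exp (- 1 :: real)"
    by simp
  then show ?thesis
    by (simp add: eval_nat_numeral)
qed

text \<open>
  The rational factor is a convergent of the Stieltjes continued fraction of
  \<open>e\<^sup>x E\<^sub>1(x)\<close>; its relative error at \<open>x = 3\<close> is below \<open>10\<^sup>-\<^sup>4\<close>.
\<close>

definition exp_integral_upper :: "real \<Rightarrow> real" where
  "exp_integral_upper x = exp (- x) *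
     ((x^4 + 19 * x^3 + 102 * x^2 + 154 * x + 24) /
      (x * (x^4 + 20 * x^3 + 120 * x^2 + 240 * x + 120)))"

text \<open>Minus the derivative of \<open>exp_integral_upper\<close>: the integrand
  \<open>exp (- x) / x\<close> of the exponential integral plus a positive error term.\<close>

definition exp_integral_upper_density :: "real \<Rightarrow> real" where
  "exp_integral_upper_density x = exp (- x) *
     (1 / x + 2880 / (x * (x^4 + 20 * x^3 + 120 * x^2 + 240 * x + 120))\<^sup>2)"

lemma exp_integral_upper_nonneg: "0 < x \<Longrightarrow> 0 \<le> exp_integral_upper x"
  by (simp add: exp_integral_upper_def)

lemma exp_integral_upper_le: "0 < x \<Longrightarrow> exp_integral_upper x \<le> exp (- x) / x"
proof -
  assume x: "0 < x"
  define q where "q = x^4 + 20 * x^3 + 120 * x^2 + 240 * x + 120"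
  have "0 < q"
    unfolding q_def using x by (intro add_pos_pos mult_pos_pos zero_less_power) auto
  have "x^4 + 19 * x^3 + 102 * x^2 + 154 * x + 24 \<le> q"
    unfolding q_def using x zero_less_power[of x 2] zero_less_power[of x 3] by linarith
  then have "(x^4 + 19 * x^3 + 102 * x^2 + 154 * x + 24) / (x * q) \<le> q / (x * q)"
    using x \<open>0 < q\<close> by (intro divide_right_mono) auto
  also have "\<dots> = 1 / x" using \<open>0 < q\<close> by simp
  finally show ?thesis
    unfolding exp_integral_upper_def q_def[symmetric]
    by (metis exp_ge_zero mult_left_mono times_divide_eq_right mult.right_neutral)
qed

lemma exp_integral_upper_density_ge: "exp (- x) / x \<le> exp_integral_upper_density x"
  by (simp add: exp_integral_upper_density_def distrib_left)

lemma DERIV_exp_integral_upper: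
  assumes x: "0 < x"
  shows "(exp_integral_upper has_real_derivative - exp_integral_upper_density x) (at x)"
proof -
  define p where "p x = x^4 + 19 * x^3 + 102 * x^2 + 154 * x + 24" for x :: real
  define q where "q x = x^4 + 20 * x^3 + 120 * x^2 + 240 * x + 120" for x :: real
  define p' where "p' = 4 * x^3 + 57 * x^2 + 204 * x + 154"
  define q' where "q' = 4 * x^3 + 60 * x^2 + 240 * x + 240"
  have "0 < q x"
    unfolding q_def using x by (intro add_pos_pos mult_pos_pos zero_less_power) auto
  have p: "(p has_real_derivative p') (at x)"
    unfolding p_def[abs_def] p'_def by (auto intro!: derivative_eq_intros)
  have q: "(q has_real_derivative q') (at x)"
    unfolding q_def[abs_def] q'_def by (auto intro!: derivative_eq_intros)
  define D where "D = (p' * (x * q x) - (q x + x * q') * p x) / (x * q x)\<^sup>2"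
  have "((\<lambda>x. x * q x) has_real_derivative q x + x * q') (at x)"
    using DERIV_mult[OF DERIV_ident q] by (simp add: mult.commute)
  from DERIV_quotient[OF p this] have "((\<lambda>x. p x / (x * q x)) has_real_derivative D) (at x)"
    using x \<open>0 < q x\<close> by (simp add: D_def numeral_2_eq_2)
  moreover have "((\<lambda>x. exp (- x)) has_real_derivative - exp (- x)) (at x)"
    by (auto intro!: derivative_eq_intros)
  ultimately have "((\<lambda>x. exp (- x) * (p x / (x * q x))) has_real_derivative
      - exp (- x) * (p x / (x * q x)) + D * exp (- x)) (at x)"
    by (rule DERIV_mult[rotated])
  also have "- exp (- x) * (p x / (x * q x)) + D * exp (- x) = exp (- x) * (D - p x / (x * q x))"
    by (simp add: algebra_simps)
  also have "D - p x / (x * q x)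
      = (p' * (x * q x) - (q x + x * q') * p x - p x * (x * q x)) / (x * q x)\<^sup>2"
    using x \<open>0 < q x\<close> by (simp add: D_def diff_divide_distrib power2_eq_square)
  \<comment> \<open>The choice of the convergent makes everything cancel except x q(x)^2 and the
    constant p(0) q(0) = 24 * 120 = 2880, whose sign yields an upper bound.\<close>
  also have "p' * (x * q x) - (q x + x * q') * p x - p x * (x * q x) = - x * (q x)\<^sup>2 - 2880"
    unfolding p_def q_def p'_def q'_def by algebra
  also have "\<dots> / (x * q x)\<^sup>2 = - (1 / x + 2880 / (x * q x)\<^sup>2)"
    using x \<open>0 < q x\<close> by (simp add: diff_divide_distrib power2_eq_square)
  finally show ?thesis
    unfolding exp_integral_upper_def[abs_def] exp_integral_upper_density_def p_def q_def
    by (simp only: mult_minus_right)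
qed

section \<open>Estimates for \<open>h\<close>\<close>

lemma h_nonneg: "0 \<le> h s"
  by (simp add: h_def)

lemma h_mult_ge3: "3 \<le> s \<Longrightarrow> s * h s = 3 * exp (- s)"
  by (auto simp: h_def)

lemma h_mult_mid: "2 \<le> s \<Longrightarrow> s \<le> 3 \<Longrightarrow> s * h s = s * exp (- s)"
  by (auto simp: h_def)

text \<open>Lets the sharper bound on [1, 3] imply the one by \<open>h\<close>. For u = s - 2 in
  [0, 1], e^u \<le> 1 + u + u^2 \<le> 2 + u = s.\<close>

lemma exp_minus_two_le_h_mult:
  assumes "1 \<le> s" "s \<le> 3"
  shows "exp (- 2) \<le> s * h s"
proof (cases "s \<le> 2")
  case True
  then show ?thesis using assms by (simp add: h_def)
next
  case False
  have "exp (s - 2) \<le> 1 + (s - 2) + (s - 2)\<^sup>2"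
    using False assms by (intro exp_bound) auto
  also have "(s - 2)\<^sup>2 \<le> 1"
    using False assms by (intro power_le_one) auto
  finally have "exp (s - 2) * exp (- s) \<le> s * exp (- s)"
    by (intro mult_right_mono) auto
  then show ?thesis
    using False assms by (simp add: h_def flip: exp_add)
qed

section \<open>Bounds for the tail integral\<close>

context
  fixes F g :: "real \<Rightarrow> real" and K N :: real
  assumes K: "0 \<le> K"
    and F: "\<And>t. 3 \<le> t \<Longrightarrow> (F has_real_derivative - g t) (at t within {3..})"
    and g: "\<And>t. 3 \<le> t \<Longrightarrow> g t \<le> K * h (t - 1)"
    and F0: "\<And>t. N \<le> t \<Longrightarrow> F t = 0"
begin

text \<open>In the application \<open>F t\<close> is t f_n(t) and \<open>g t\<close> is f_{n-1}(t -
  1). For t > 4 the bound h(t - 1) is 3 exp(-(t - 1)) / (t - 1), an exponential integrand. The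
  comparison ends at \<open>max s N\<close>, where \<open>F\<close> vanishes.\<close>

lemma tail_le_exp_integral:
  assumes s: "4 \<le> s"
  shows "F s \<le> K * (3 * exp_integral_upper (s - 1))"
proof (rule le_of_deriv_le[where F = F and g = g and a = s and b = "max s N"
      and G = "\<lambda>s. K * (3 * exp_integral_upper (s - 1))"
      and d = "\<lambda>t. K * (3 * exp_integral_upper_density (t - 1))"])
  show "(F has_real_derivative - g t) (at t within {s..})" if "s \<le> t" for t
    using F[of t] that s by (auto intro: DERIV_subset)
  show "((\<lambda>t. K * (3 * exp_integral_upper (t - 1))) has_real_derivative
      - (K * (3 * exp_integral_upper_density (t - 1)))) (at t)" if "s \<le> t" for t
    using that s
    by (auto intro!: derivative_eq_intros DERIV_chain2[OF DERIV_exp_integral_upper])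
  show "g t \<le> K * (3 * exp_integral_upper_density (t - 1))" if "s < t" for t
  proof -
    have "g t \<le> K * h (t - 1)" using g that s by simp
    also have "h (t - 1) = 3 * (exp (- (t - 1)) / (t - 1))"
      using that s by (simp add: h_def divide_inverse)
    also have "K * \<dots> \<le> K * (3 * exp_integral_upper_density (t - 1))"
      using K by (intro mult_left_mono exp_integral_upper_density_ge) auto
    finally show ?thesis .
  qed
  show "F (max s N) \<le> K * (3 * exp_integral_upper (max s N - 1))"
    using F0[of "max s N"] K s by (simp add: exp_integral_upper_nonneg)
qed auto

text \<open>For t in [3, 4] the bound h(t - 1) is exp(1 - t), which integrates to the first two
  terms; the third is the bound at 4.\<close>

lemma tail_le_mid:
  assumes s: "3 \<le> s" "s \<le> 4"
  shows "F s \<le> K * (exp (1 - s) - exp (- 3) + 3 * exp_integral_upper 3)"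
proof (rule le_of_deriv_le[where F = F and g = g and a = s and b = 4
      and G = "\<lambda>s. K * (exp (1 - s) - exp (- 3) + 3 * exp_integral_upper 3)"
      and d = "\<lambda>t. K * exp (1 - t)"])
  show "(F has_real_derivative - g t) (at t within {s..})" if "s \<le> t" for t
    using F[of t] that s by (auto intro: DERIV_subset)
  show "((\<lambda>s. K * (exp (1 - s) - exp (- 3) + 3 * exp_integral_upper 3)) has_real_derivative
      - (K * exp (1 - t))) (at t)" for t
    by (auto intro!: derivative_eq_intros)
  show "g t \<le> K * exp (1 - t)" if "s < t" "t < 4" for t
    using g[of t] that s by (simp add: h_def)
  show "F 4 \<le> K * (exp (1 - 4) - exp (- 3) + 3 * exp_integral_upper 3)"
    using tail_le_exp_integral[of 4] by simp
qed (use s in auto)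

lemma tail_at_3_le: "F 3 \<le> 0.9214 * K * exp (- 2)"
proof -
  have "exp (- 3) = exp (- 1) * exp (- 2 :: real)" by (simp flip: exp_add)
  moreover have "exp_integral_upper 3 = 1998 / 7623 * exp (- 3)"
    by (simp add: exp_integral_upper_def)
  ultimately have "exp (1 - 3) - exp (- 3) + 3 * exp_integral_upper 3
      = (1 - (1 - 3 * (1998 / 7623)) * exp (- 1)) * exp (- 2)"
    by (simp add: algebra_simps)
  \<comment> \<open>With \<open>exp_minus_one_ge\<close> the factor is at most 0.921393, leaving
    slack below 10^(-5).\<close>
  also have "\<dots> \<le> 0.9214 * exp (- 2)"
    using exp_minus_one_ge by (intro mult_right_mono) auto
  finally have "K * (exp (1 - 3) - exp (- 3) + 3 * exp_integral_upper 3) \<le> K * (0.9214 * exp (- 2))"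
    using K by (intro mult_left_mono) auto
  with tail_le_mid[of 3] have "F 3 \<le> K * (0.9214 * exp (- 2))" by linarith
  then show ?thesis by (simp add: mult_ac)
qed

text \<open>On both sides of 4 the tail is at most K exp(1 - s), and e \<le> 3 * 0.9214 turns this
  into the claim, as s h(s) = 3 exp(-s).\<close>

lemma tail_le_h_mult:
  assumes s: "3 \<le> s"
  shows "F s \<le> 0.9214 * K * (s * h s)"
proof -
  have e: "exp (1 - s) \<le> 3 * 0.9214 * exp (- s)"
  proof -
    have "exp (- s) = exp (- 1) * exp (1 - s)" by (simp flip: exp_add)
    moreover have "1 * exp (1 - s) \<le> (3 * 0.9214 * exp (- 1)) * exp (1 - s)"
      using exp_minus_one_ge by (intro mult_right_mono) auto
    ultimately show ?thesis by simp
  qed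
  have "F s \<le> K * exp (1 - s)"
  proof (cases "s \<le> 4")
    case True
    have "3 * exp_integral_upper 3 \<le> exp (- 3)"
      using exp_integral_upper_le[of 3] by simp
    then have "K * (exp (1 - s) - exp (- 3) + 3 * exp_integral_upper 3) \<le> K * exp (1 - s)"
      using K by (intro mult_left_mono) auto
    with tail_le_mid[OF s True] show ?thesis by simp
  next
    case False
    have "3 * exp_integral_upper (s - 1) \<le> 3 * (exp (- (s - 1)) / (s - 1))"
      using False by (intro mult_left_mono exp_integral_upper_le) auto
    also have "\<dots> \<le> exp (1 - s)"
      using False by (simp add: field_simps)
    finally have "K * (3 * exp_integral_upper (s - 1)) \<le> K * exp (1 - s)"
      using K by (rule mult_left_mono)
    with tail_le_exp_integral[of s] False show ?thesis by simp
  qed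
  also have "\<dots> \<le> K * (3 * 0.9214 * exp (- s))"
    using e K by (rule mult_left_mono)
  finally show ?thesis using s by (simp add: h_mult_ge3 mult_ac)
qed

end

text \<open>
  On \<open>[1, 2]\<close> the function \<open>1/t\<close> is replaced by its chord \<open>(3 - t)/2\<close>; this keeps the
  comparison function quadratic.
\<close>

lemma tail_le_h_mult_near:
  fixes F g :: "real \<Rightarrow> real"
  assumes K: "0 \<le> K"
    and F: "\<And>t. 2 \<le> t \<Longrightarrow> (F has_real_derivative - g t) (at t within {2..})"
    and g: "\<And>t. 2 \<le> t \<Longrightarrow> t \<le> 3 \<Longrightarrow> (t - 1) * g t \<le> K * exp (- 2)"
    and F3: "F 3 \<le> 0.9214 * K * exp (- 2)"
    and s: "2 \<le> s" "s \<le> 3"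
  shows "F s \<le> 0.9214 * K * (s * h s)"
proof -
  have "F s \<le> K * exp (- 2) * ((4 - s)\<^sup>2 / 4 - 1 / 4 + 0.9214)"
  proof (rule le_of_deriv_le[where F = F and g = g and a = s and b = 3
        and G = "\<lambda>s. K * exp (- 2) * ((4 - s)\<^sup>2 / 4 - 1 / 4 + 0.9214)"
        and d = "\<lambda>t. K * exp (- 2) * ((4 - t) / 2)"])
    show "(F has_real_derivative - g t) (at t within {s..})" if "s \<le> t" for t
      using F[of t] that s by (auto intro: DERIV_subset)
    show "((\<lambda>s. K * exp (- 2) * ((4 - s)\<^sup>2 / 4 - 1 / 4 + 0.9214)) has_real_derivative
        - (K * exp (- 2) * ((4 - t) / 2))) (at t)" for t
      by (auto intro!: derivative_eq_intros simp: field_simps)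
    show "g t \<le> K * exp (- 2) * ((4 - t) / 2)" if "s < t" "t < 3" for t
    proof -
      have "0 \<le> (t - 2) * (3 - t)" using that s by simp
      then have "1 \<le> (t - 1) * ((4 - t) / 2)" by (simp add: field_simps)
      then have "K * exp (- 2) * 1 \<le> K * exp (- 2) * ((t - 1) * ((4 - t) / 2))"
        using K by (intro mult_left_mono) auto
      with g[of t] that s
      have "(t - 1) * g t \<le> K * exp (- 2) * ((t - 1) * ((4 - t) / 2))" by linarith
      then have "(t - 1) * g t \<le> (t - 1) * (K * exp (- 2) * ((4 - t) / 2))"
        by (simp only: mult_ac)
      then show ?thesis using that s by (subst (asm) mult_le_cancel_left_pos) auto
    qed
    show "F 3 \<le> K * exp (- 2) * ((4 - 3)\<^sup>2 / 4 - 1 / 4 + 0.9214)"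
      using F3 by (simp add: mult_ac)
  qed (use s in auto)
  also have "\<dots> \<le> K * exp (- 2) * (0.9214 * (s * exp (2 - s)))"
  proof (intro mult_left_mono)
    define v where "v = 3 - s"
    have v: "0 \<le> v" "v \<le> 1" using s by (auto simp: v_def)
    have "v\<^sup>2 \<le> v" "v ^ 3 \<le> v"
      using v power_decreasing[of 1 2 v] power_decreasing[of 1 3 v] by auto
    have eq: "(1 + v)\<^sup>2 = 1 + 2 * v + v\<^sup>2"
      "(3 - v) * (1 + v + v\<^sup>2 / 2) = 3 + 2 * v + v\<^sup>2 / 2 - v ^ 3 / 2"
      by (simp_all add: field_simps power2_eq_square power3_eq_cube)
    \<comment> \<open>0.338 lies below 0.9214 / e, and 1 + v + v^2/2 below e^v. Since v^2 and v^3
      are at most v, the cubic inequality reduces to a linear one.\<close>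
    have "(1 + v)\<^sup>2 / 4 - 1 / 4 + 0.9214 \<le> 0.338 * ((3 - v) * (1 + v + v\<^sup>2 / 2))"
      unfolding eq using v \<open>v\<^sup>2 \<le> v\<close> \<open>v ^ 3 \<le> v\<close> by (simp add: field_simps)
    also have "\<dots> \<le> (0.9214 * exp (- 1)) * ((3 - v) * exp v)"
      using exp_minus_one_ge v exp_lower_Taylor_quadratic[of v]
      by (intro mult_mono) auto
    also have "\<dots> = 0.9214 * (s * exp (2 - s))"
      by (simp add: v_def flip: exp_add)
    finally show "(4 - s)\<^sup>2 / 4 - 1 / 4 + 0.9214 \<le> 0.9214 * (s * exp (2 - s))"
      by (simp add: v_def)
  qed (use K in auto)
  also have "\<dots> = 0.9214 * K * (s * h s)"
    using s by (simp add: h_mult_mid flip: exp_add)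
  finally show ?thesis .
qed

section \<open>The functions f_n and the induction\<close>

context
  fixes f :: "nat \<Rightarrow> real \<Rightarrow> real"
  assumes f: "sieve_functions f"
begin

lemma sieve_functions_eq_0: "1 \<le> n \<Longrightarrow> real n + 2 \<le> s \<Longrightarrow> f n s = 0"
  using f[unfolded sieve_functions_def, THEN conjunct1] by simp

lemma sieve_functions_1: "1 \<le> s \<Longrightarrow> s \<le> 3 \<Longrightarrow> s * f 1 s = 3 - s"
  using f[unfolded sieve_functions_def, THEN conjunct2, THEN conjunct1] by simp

text \<open>The parity in this name and the next is that of \<open>Suc n\<close>.\<close>

lemma DERIV_sieve_functions_even:
  "odd n \<Longrightarrow> 2 \<le> s \<Longrightarrow>
    ((\<lambda>t. t * f (Suc n) t) has_real_derivative - f n (s - 1)) (at s within {2..})"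
  using f[unfolded sieve_functions_def, THEN conjunct2, THEN conjunct2, THEN conjunct1,
      rule_format, of "Suc n" s]
  by (cases n) auto

lemma DERIV_sieve_functions_odd:
  "even n \<Longrightarrow> 1 \<le> n \<Longrightarrow> 3 \<le> s \<Longrightarrow>
    ((\<lambda>t. t * f (Suc n) t) has_real_derivative - f n (s - 1)) (at s within {3..})"
  using f[unfolded sieve_functions_def, THEN conjunct2, THEN conjunct2, THEN conjunct2,
      THEN conjunct1, rule_format, of "Suc n" s]
  by simp

text \<open>Carries the estimate at 3 back over [1, 3].\<close>

lemma sieve_functions_odd_const:
  assumes "even n" "1 \<le> n" "1 \<le> s" "s \<le> 3"
  shows "s * f (Suc n) s = 3 * f (Suc n) 3"
proof (cases "s = 3")
  case False
  define F where "F t = t * f (Suc n) t" for t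
  have F: "(F has_real_derivative 0) (at t within {1..3})" if "1 \<le> t" "t \<le> 3" for t
    using f[unfolded sieve_functions_def, THEN conjunct2, THEN conjunct2, THEN conjunct2,
        THEN conjunct2, rule_format, of "Suc n" t] that assms(1,2)
    unfolding F_def[abs_def] by simp
  have "F 3 = F s"
  proof (rule DERIV_isconst_end[of s 3 F])
    show "s < 3" using assms False by simp
    have "continuous_on {1..3} F"
      using F by (intro DERIV_continuous_on[of _ _ "\<lambda>_. 0"]) auto
    then show "continuous_on {s..3} F"
      by (rule continuous_on_subset) (use assms in auto)
    show "(F has_real_derivative 0) (at x)" if "s < x" "x < 3" for x
    proof -
      have "at x within {1..3} = at x"
        using that assms by (intro at_within_open_subset[of _ "{1<..<3}"]) auto
      then show ?thesis using F[of x] that assms by simp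
    qed
  qed
  then show ?thesis by (simp add: F_def)
qed simp

text \<open>The condition on \<open>A\<close> is what the base case uses: s f_1(s) = 3 - s \<le>
  2.\<close>

lemma sieve_functions_bound:
  fixes A :: real
  assumes A: "2 \<le> A * exp (- 2)" and "1 \<le> n"
  shows "(odd n \<longrightarrow> (\<forall>s\<ge>1. s \<le> 3 \<longrightarrow> s * f n s \<le> A * 0.9214 ^ (n - 1) * exp (- 2))) \<and>
    (\<forall>s\<ge>if odd n then 1 else 2. f n s \<le> A * 0.9214 ^ (n - 1) * h s)"
proof -
  have "0 \<le> A"
    using A zero_le_mult_iff[of A "exp (- 2)"] not_exp_le_zero[of "- 2 :: real"] by linarith
  have f_le: "f n s \<le> K * h s"
    if "s * f n s \<le> K * exp (- 2)" "1 \<le> s" "s \<le> 3" "0 \<le> K" for n s K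
  proof -
    have "s * f n s \<le> K * (s * h s)"
      using mult_left_mono[OF exp_minus_two_le_h_mult[OF that(2,3)] that(4)] that(1) by linarith
    then have "s * f n s \<le> s * (K * h s)" by (simp only: mult_ac)
    then show ?thesis using that(2) by simp
  qed
  show ?thesis
    using \<open>1 \<le> n\<close>
  proof (induction n rule: dec_induct)
    case base
    have one: "s * f 1 s \<le> A * exp (- 2)" if "1 \<le> s" "s \<le> 3" for s
      using A that sieve_functions_1[of s] by linarith
    have "f 1 s \<le> A * h s" if "1 \<le> s" for s
    proof (cases "s \<le> 3")
      case True
      then show ?thesis using f_le[OF one] that \<open>0 \<le> A\<close> by simp
    next
      case False
      then show ?thesis using sieve_functions_eq_0[of 1 s] \<open>0 \<le> A\<close> by (simp add: h_nonneg)
    qed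
    with one show ?case by simp
  next
    case (step n)
    define K where "K = A * 0.9214 ^ (n - 1)"
    have K: "0 \<le> K" unfolding K_def using \<open>0 \<le> A\<close> by simp
    have K_Suc: "A * 0.9214 ^ (Suc n - 1) = 0.9214 * K"
      unfolding K_def using step.hyps(1) by (cases n) auto
    define F where "F t = t * f (Suc n) t" for t
    define g where "g t = f n (t - 1)" for t
    have IH: "f n t \<le> K * h t" if "(if odd n then 1 else 2) \<le> t" for t
      using step.IH[THEN conjunct2] that unfolding K_def by blast
    have F0: "F t = 0" if "real (Suc n) + 2 \<le> t" for t
      using sieve_functions_eq_0[of "Suc n" t] that by (simp add: F_def)
    \<comment> \<open>As t - 1 \<ge> 2 lies in the domain for either parity, the tail lemmas from 3
      on serve both cases.\<close>
    have g: "g t \<le> K * h (t - 1)" if "3 \<le> t" for t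
      unfolding g_def using that by (intro IH) auto
    have from_F: "f (Suc n) s \<le> 0.9214 * K * h s"
      if "F s \<le> 0.9214 * K * (s * h s)" "1 \<le> s" for s
    proof -
      have "s * f (Suc n) s \<le> s * (0.9214 * K * h s)"
        using that(1) unfolding F_def by (simp only: mult_ac)
      then show ?thesis using that(2) by (subst (asm) mult_le_cancel_left_pos) auto
    qed
    show ?case
    proof (cases "odd n")
      case True
      have F2: "(F has_real_derivative - g t) (at t within {2..})" if "2 \<le> t" for t
        using DERIV_sieve_functions_even[OF True that] unfolding F_def[abs_def] g_def .
      then have F3: "(F has_real_derivative - g t) (at t within {3..})" if "3 \<le> t" for t
        using that by (intro DERIV_subset[OF F2]) auto
      \<comment> \<open>Here t - 1 is in [1, 2], where the strengthened hypothesis for odd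
        \<open>n\<close> applies.\<close>
      have near: "(t - 1) * g t \<le> K * exp (- 2)" if "2 \<le> t" "t \<le> 3" for t
        using step.IH[THEN conjunct1] True that unfolding K_def g_def by simp
      have "f (Suc n) s \<le> 0.9214 * K * h s" if "2 \<le> s" for s
      proof (cases "s \<le> 3")
        case True
        show ?thesis
          using tail_le_h_mult_near[OF K F2 near tail_at_3_le[OF K F3 g F0] that True] that
          by (intro from_F) auto
      next
        case False
        then show ?thesis
          by (intro from_F tail_le_h_mult[OF K F3 g F0]) auto
      qed
      then show ?thesis unfolding K_Suc using True by simp
    next
      case False
      then have n: "even n" "1 \<le> n" using step.hyps(1) by auto
      have F3: "(F has_real_derivative - g t) (at t within {3..})" if "3 \<le> t" for t
        using DERIV_sieve_functions_odd[OF n that] unfolding F_def[abs_def] g_def .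
      have low: "s * f (Suc n) s \<le> 0.9214 * K * exp (- 2)" if "1 \<le> s" "s \<le> 3" for s
        using sieve_functions_odd_const[OF n that] tail_at_3_le[OF K F3 g F0] by (simp add: F_def)
      have "f (Suc n) s \<le> 0.9214 * K * h s" if "1 \<le> s" for s
      proof (cases "s \<le> 3")
        case True
        show ?thesis using K by (intro f_le[OF low[OF that True] that True]) simp
      next
        case False
        then show ?thesis
          by (intro from_F tail_le_h_mult[OF K F3 g F0]) auto
      qed
      with low show ?thesis unfolding K_Suc using n by simp
    qed
  qed
qed

end

theorem theorem3:
  fixes f :: "nat \<Rightarrow> real \<Rightarrow> real" and n :: nat and s :: real
  assumes "sieve_functions f"
    and "n \<ge> 1"
    and "(odd n \<and> s \<ge> 1) \<or> (even n \<and> s \<ge> 2)"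
  shows "f n s \<le> 2 * (exp 1)\<^sup>2 * 0.9214 ^ (n - 1) * h s"
proof -
  \<comment> \<open>2 e^2 is the least \<open>A\<close> that \<open>sieve_functions_bound\<close>
    admits.\<close>
  have "2 \<le> 2 * (exp 1)\<^sup>2 * exp (- 2 :: real)"
    by (simp add: power2_eq_square flip: exp_add)
  from sieve_functions_bound[OF assms(1) this assms(2)] assms(3) show ?thesis
    by (auto split: if_splits)
qed

end
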